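(* Let $(G,w)$ be a connected weighted graph (possibly infinite) whose weight $w\colon E(G)\to[0,\infty)$ is metrizable. The set $\mathfrak M_w$ consists of exactly one element $\rho$ if and only if the following condition holds: for every two distinct non-adjacent vertices $u,v\in V(G)$ there exists a sequence $(P_n)_{n\in\mathbb N}$ (possibly stationary, i.e. constant) of paths $P_n\in\mathcal P_{u,v}$ such that $$2\max_{e\in E(P_n)}w(e)-w(P_n)\rightarrow d_w(u,v)-0\quad\text{as } n\to\infty.$$ Moreover, if this condition holds, then the unique element $\rho$ of $\mathfrak M_w$ satisfies $\rho(u,v)=d_w(u,v)$ for all $u,v\in V(G)$.
   Context: A graph $G=(V,E)$ consists of a nonempty set $V=V(G)$ of vertices (possibly infinite) and a (possibly empty) set $E=E(G)$ of unordered pairs of distinct elements of $V$. Vertices $u,v$ are adjacent if $\{u,v\}\in E(G)$. A path in $G$ is a finite subgraph $P$ with $V(P)=\{x_0,\dots,x_k\}$, all $x_i$ distinct, and $E(P)=\{\{x_0,x_1\},\dots,\{x_{k-1},x_k\}\}$; it joins $x_0$ and $x_k$. $G$ is connected if any two distinct vertices are joined by a path. $\mathcal P_{u,v}$ denotes the set of all paths in $G$ joining $u$ and $v$. A weighted graph $(G,w)$ is a graph $G$ with a weight $w\colon E(G)\to\mathbb R^+=[0,\infty)$. For a path $P$, $w(P)=\sum_{e\in E(P)}w(e)$. For connected $G$, the shortest-path pseudometric is $d_w(u,v)=\inf\{w(P):P\in\mathcal P_{u,v}\}$ for $u\ne v$, and $d_w(u,u)=0$. A pseudometric on a set $X$ is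 a function $d\colon X\times X\to[0,\infty)$ with $d(x,x)=0$, $d(x,y)=d(y,x)$ and $d(x,y)\le d(x,z)+d(z,y)$ for all $x,y,z\in X$; it is a metric if moreover $d(x,y)=0$ implies $x=y$. The weight $w$ is pseudometrizable if there is a pseudometric $d$ on $V(G)$ with $d(u,v)=w(\{u,v\})$ for all $\{u,v\}\in E(G)$. The weight $w$ on a connected graph is metrizable if it is pseudometrizable and $d_w$ is a metric on $V(G)$. For a pseudometrizable weight $w$, $\mathfrak M_w$ denotes the set of all pseudometrics $\rho$ on $V(G)$ with $\rho(u,v)=w(\{u,v\})$ for every $\{u,v\}\in E(G)$. For a real sequence $(a_n)$ and a real number $a$, the notation $a_n\to a-0$ means that $a_n\to a$ and $a_n\le a$ for all $n\in\mathbb N$. *)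

theory Defs
  imports Complex_Main "HOL-Library.FuncSet"
begin

text \<open>Possibly infinite simple graphs; an edge is an unordered pair, i.e. a two-element set.\<close>

record 'a ugraph =
  verts :: "'a set"
  edges :: "'a set set"

definition simple_graph :: "'a ugraph \<Rightarrow> bool" where
  "simple_graph G \<longleftrightarrow> verts G \<noteq> {} \<and>
     (\<forall>e\<in>edges G. \<exists>u\<in>verts G. \<exists>v\<in>verts G. u \<noteq> v \<and> e = {u, v})"

definition adjacent :: "'a ugraph \<Rightarrow> 'a \<Rightarrow> 'a \<Rightarrow> bool" where
  "adjacent G u v \<longleftrightarrow> {u, v} \<in> edges G"

definition subgraph :: "'a ugraph \<Rightarrow> 'a ugraph \<Rightarrow> bool" where
  "subgraph H G \<longleftrightarrow> simple_graph H \<and> verts H \<subseteq> verts G \<and> edges H \<subseteq> edges G"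

text \<open>
  Paths are subgraphs, not vertex sequences: \<open>x\<close> enumerates the distinct vertices
  \<open>x 0, \<dots>, x k\<close>, and its values beyond \<open>k\<close> are irrelevant. Reversing the enumeration shows
  that \<open>paths G u v = paths G v u\<close>.
\<close>

definition paths :: "'a ugraph \<Rightarrow> 'a \<Rightarrow> 'a \<Rightarrow> 'a ugraph set" where
  "paths G u v = {P. subgraph P G \<and>
     (\<exists>(k::nat) x. inj_on x {..k} \<and> x 0 = u \<and> x k = v \<and>
        verts P = x ` {..k} \<and> edges P = (\<lambda>i. {x i, x (Suc i)}) ` {..<k})}"

definition connected_graph :: "'a ugraph \<Rightarrow> bool" where
  "connected_graph G \<longleftrightarrow> simple_graph G \<and>
     (\<forall>u\<in>verts G. \<forall>v\<in>verts G. u \<noteq> v \<longrightarrow> paths G u v \<noteq> {})"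

text \<open>Only the values of a weight on the edges of the graph matter.\<close>

definition weighted_graph :: "'a ugraph \<Rightarrow> ('a set \<Rightarrow> real) \<Rightarrow> bool" where
  "weighted_graph G w \<longleftrightarrow> simple_graph G \<and> (\<forall>e\<in>edges G. 0 \<le> w e)"

definition path_weight :: "('a set \<Rightarrow> real) \<Rightarrow> 'a ugraph \<Rightarrow> real" where
  "path_weight w P = (\<Sum>e\<in>edges P. w e)"

text \<open>
  A function on \<open>X \<times> X\<close> is a total HOL function that is \<open>undefined\<close> off \<open>X \<times> X\<close>, so that
  counting pseudometrics as elements of a set is meaningful. (The library locale
  \<open>Metric_space\<close> is not used because it demands nonnegativity and symmetry off the carrier too.)
\<close>

definition pseudometric_on :: "'a set \<Rightarrow> ('a \<times> 'a \<Rightarrow> real) \<Rightarrow> bool" where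
  "pseudometric_on X d \<longleftrightarrow> d \<in> X \<times> X \<rightarrow>\<^sub>E {0..} \<and>
     (\<forall>x\<in>X. d (x, x) = 0) \<and>
     (\<forall>x\<in>X. \<forall>y\<in>X. d (x, y) = d (y, x)) \<and>
     (\<forall>x\<in>X. \<forall>y\<in>X. \<forall>z\<in>X. d (x, y) \<le> d (x, z) + d (z, y))"

definition metric_on :: "'a set \<Rightarrow> ('a \<times> 'a \<Rightarrow> real) \<Rightarrow> bool" where
  "metric_on X d \<longleftrightarrow> pseudometric_on X d \<and> (\<forall>x\<in>X. \<forall>y\<in>X. d (x, y) = 0 \<longrightarrow> x = y)"

text \<open>
  Meaningful for connected \<open>G\<close> and nonnegative \<open>w\<close>: then the infimum is over a nonempty set
  that is bounded below by 0.
\<close>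

definition sp_dist :: "'a ugraph \<Rightarrow> ('a set \<Rightarrow> real) \<Rightarrow> 'a \<times> 'a \<Rightarrow> real" where
  "sp_dist G w = (\<lambda>(u, v)\<in>verts G \<times> verts G.
     if u = v then 0 else (INF P\<in>paths G u v. path_weight w P))"

definition pseudometrics_extending ::
    "'a ugraph \<Rightarrow> ('a set \<Rightarrow> real) \<Rightarrow> ('a \<times> 'a \<Rightarrow> real) set" where
  "pseudometrics_extending G w = {d. pseudometric_on (verts G) d \<and>
     (\<forall>u\<in>verts G. \<forall>v\<in>verts G. {u, v} \<in> edges G \<longrightarrow> d (u, v) = w {u, v})}"

definition pseudometrizable :: "'a ugraph \<Rightarrow> ('a set \<Rightarrow> real) \<Rightarrow> bool" where
  "pseudometrizable G w \<longleftrightarrow> (\<exists>d. d \<in> pseudometrics_extending G w)"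

definition metrizable :: "'a ugraph \<Rightarrow> ('a set \<Rightarrow> real) \<Rightarrow> bool" where
  "metrizable G w \<longleftrightarrow> pseudometrizable G w \<and> metric_on (verts G) (sp_dist G w)"

text \<open>The notation \<open>a\<^sub>n \<rightarrow> L - 0\<close>; the inequality is not strict and holds for every \<open>n\<close>.\<close>

definition tends_from_below :: "(nat \<Rightarrow> real) \<Rightarrow> real \<Rightarrow> bool" where
  "tends_from_below a L \<longleftrightarrow> a \<longlonglongrightarrow> L \<and> (\<forall>n. a n \<le> L)"

text \<open>
  The maximum is over a finite nonempty set, as a path joining distinct vertices has an edge.
\<close>

definition path_condition :: "'a ugraph \<Rightarrow> ('a set \<Rightarrow> real) \<Rightarrow> bool" where
  "path_condition G w \<longleftrightarrow>
     (\<forall>u\<in>verts G. \<forall>v\<in>verts G. u \<noteq> v \<and> \<not> adjacent G u v \<longrightarrow>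
       (\<exists>P :: nat \<Rightarrow> 'a ugraph. (\<forall>n. P n \<in> paths G u v) \<and>
          tends_from_below
            (\<lambda>n. 2 * (MAX e\<in>edges (P n). w e) - path_weight w (P n))
            (sp_dist G w (u, v))))"

end

theory Submission
  imports Defs
begin

text \<open>
  The shortest-path pseudometric \<open>d\<close> is the largest element of \<open>pseudometrics_extending G w\<close>.
  If \<open>\<rho>\<close> extends \<open>w\<close> and \<open>e\<close> is an edge of a path \<open>P\<close> from \<open>u\<close> to \<open>v\<close>, the polygon inequality
  for the cycle closed by \<open>u, v\<close> gives \<open>2 w(e) - w(P) \<le> \<rho>(u, v) \<le> d(u, v)\<close>, so the path condition
  forces \<open>\<rho> = d\<close>. Conversely, if \<open>2 w(e) - w(P) \<le> t\<close> for all such \<open>P\<close> and \<open>e\<close>, where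
  \<open>0 \<le> t < d(u, v)\<close>, then adding a shortcut of length \<open>t\<close> between \<open>u\<close> and \<open>v\<close> to the metric \<open>d\<close>
  shortens no edge of \<open>G\<close>: going from one end of the edge \<open>e\<close> to the other through the shortcut
  amounts to a path from \<open>u\<close> to \<open>v\<close> through \<open>e\<close>, unless the two parts of the detour meet, in which
  case they alone are at least as long as \<open>e\<close>. This gives a second extension of \<open>w\<close>.
\<close>

section \<open>Paths as enumerated vertex sequences\<close>

definition path_enum :: "'a ugraph \<Rightarrow> nat \<Rightarrow> (nat \<Rightarrow> 'a) \<Rightarrow> bool" where
  "path_enum G k x \<longleftrightarrow> inj_on x {..k} \<and> x ` {..k} \<subseteq> verts G \<and>
     (\<forall>i<k. {x i, x (Suc i)} \<in> edges G)"

definition path_of :: "nat \<Rightarrow> (nat \<Rightarrow> 'a) \<Rightarrow> 'a ugraph" where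
  "path_of k x = \<lparr>verts = x ` {..k}, edges = (\<lambda>i. {x i, x (Suc i)}) ` {..<k}\<rparr>"

lemma path_enum_vert: "path_enum G k x \<Longrightarrow> i \<le> k \<Longrightarrow> x i \<in> verts G"
  by (auto simp: path_enum_def)

lemma path_enum_edge: "path_enum G k x \<Longrightarrow> i < k \<Longrightarrow> {x i, x (Suc i)} \<in> edges G"
  by (auto simp: path_enum_def)

lemma path_of_in_paths:
  assumes "path_enum G k x"
  shows "path_of k x \<in> paths G (x 0) (x k)"
proof -
  have "simple_graph (path_of k x)"
    unfolding simple_graph_def
  proof (intro conjI ballI)
    show "verts (path_of k x) \<noteq> {}" by (auto simp: path_of_def)
    fix e assume "e \<in> edges (path_of k x)"
    then obtain i where i: "i < k" "e = {x i, x (Suc i)}" by (auto simp: path_of_def)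
    moreover have "x i \<noteq> x (Suc i)"
      using assms i(1) inj_onD[of x "{..k}" i "Suc i"] by (auto simp: path_enum_def)
    ultimately show "\<exists>u\<in>verts (path_of k x). \<exists>v\<in>verts (path_of k x). u \<noteq> v \<and> e = {u, v}"
      by (intro bexI[of _ "x i"] bexI[of _ "x (Suc i)"]) (auto simp: path_of_def)
  qed
  then have "subgraph (path_of k x) G"
    using assms by (auto simp: subgraph_def path_of_def path_enum_def)
  then show ?thesis
    using assms unfolding paths_def path_enum_def
    by (auto simp: path_of_def intro!: exI[of _ k] exI[of _ x])
qed

lemma pathsE:
  assumes "P \<in> paths G u v"
  obtains k x where "path_enum G k x" "x 0 = u" "x k = v" "P = path_of k x"
proof -
  obtain k x where *: "subgraph P G" "inj_on x {..k}" "x 0 = u" "x k = v"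
    "verts P = x ` {..k}" "edges P = (\<lambda>i. {x i, x (Suc i)}) ` {..<k}"
    using assms by (auto simp: paths_def)
  show thesis
  proof
    show "path_enum G k x"
      using * by (auto simp: path_enum_def subgraph_def)
    show "P = path_of k x"
      using * by (simp add: path_of_def)
  qed (use * in auto)
qed

text \<open>The weight of a path is a sum over a set of edges; it becomes a sum over indices because
  distinct indices give distinct edges.\<close>

lemma path_weight_path_of:
  assumes "path_enum G k x"
  shows "path_weight w (path_of k x) = (\<Sum>i<k. w {x i, x (Suc i)})"
proof -
  have inj: "inj_on x {..k}" using assms by (simp add: path_enum_def)
  have "inj_on (\<lambda>i. {x i, x (Suc i)}) {..<k}"
  proof (rule inj_onI)
    fix i j assume ij: "i \<in> {..<k}" "j \<in> {..<k}" "{x i, x (Suc i)} = {x j, x (Suc j)}"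
    then have "x i = x j \<or> x i = x (Suc j) \<and> x (Suc i) = x j"
      by (auto simp: doubleton_eq_iff)
    \<comment> \<open>The crossed alternative would make each index the successor of the other,
      which is absurd.\<close>
    then have "i = j \<or> i = Suc j \<and> Suc i = j"
      using ij(1,2) inj by (auto simp: inj_on_eq_iff)
    then show "i = j" by auto
  qed
  then show ?thesis
    by (simp add: path_weight_def path_of_def sum.reindex)
qed

section \<open>Bounds along paths for pseudometrics that extend the weight\<close>

text \<open>One triangle inequality per edge. The form with a segment from \<open>i\<close> to
  \<open>j\<close> allows a path to be cut at a vertex or around an edge.\<close>

lemma pseudometrics_extending_chain:
  assumes \<rho>: "\<rho> \<in> pseudometrics_extending G w" and p: "path_enum G k x"
    and "i \<le> j" "j \<le> k"
  shows "\<rho> (x i, x j) \<le> (\<Sum>l=i..<j. w {x l, x (Suc l)})"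
  using assms(3,4)
proof (induction j rule: dec_induct)
  case base
  then show ?case
    using \<rho> path_enum_vert[OF p] by (simp add: pseudometrics_extending_def pseudometric_on_def)
next
  case (step j)
  then have V: "x i \<in> verts G" "x j \<in> verts G" "x (Suc j) \<in> verts G"
    using path_enum_vert[OF p] by auto
  have "\<rho> (x i, x (Suc j)) \<le> \<rho> (x i, x j) + \<rho> (x j, x (Suc j))"
    using \<rho> V by (auto simp: pseudometrics_extending_def pseudometric_on_def)
  also have "\<rho> (x j, x (Suc j)) = w {x j, x (Suc j)}"
    using \<rho> V path_enum_edge[OF p, of j] step by (auto simp: pseudometrics_extending_def)
  finally show ?case using step by simp
qed

lemma pseudometrics_extending_le_path_weight:
  assumes "\<rho> \<in> pseudometrics_extending G w" "P \<in> paths G u v"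
  shows "\<rho> (u, v) \<le> path_weight w P"
proof -
  obtain k x where *: "path_enum G k x" "x 0 = u" "x k = v" "P = path_of k x"
    using assms(2) by (rule pathsE)
  show ?thesis
    using pseudometrics_extending_chain[OF assms(1) *(1), of 0 k] *
    by (simp add: path_weight_path_of atLeast0LessThan)
qed

lemma pseudometrics_extending_via_le_path_weight:
  assumes \<rho>: "\<rho> \<in> pseudometrics_extending G w" and P: "P \<in> paths G u v" and z: "z \<in> verts P"
  shows "\<rho> (u, z) + \<rho> (z, v) \<le> path_weight w P"
proof -
  obtain k x where *: "path_enum G k x" "x 0 = u" "x k = v" "P = path_of k x"
    using P by (rule pathsE)
  obtain j where j: "j \<le> k" "z = x j" using z * by (auto simp: path_of_def)
  have "path_weight w P = (\<Sum>l=0..<j. w {x l, x (Suc l)}) + (\<Sum>l=j..<k. w {x l, x (Suc l)})"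
    using * j by (simp add: path_weight_path_of sum.atLeastLessThan_concat flip: atLeast0LessThan)
  then show ?thesis
    using pseudometrics_extending_chain[OF \<rho> *(1), of 0 j]
      pseudometrics_extending_chain[OF \<rho> *(1), of j k] * j by simp
qed

text \<open>Polygon inequality: the edge \<open>e\<close> is at most the two pieces of
  \<open>P\<close> left after its removal together with the closing side from \<open>u\<close> to
  \<open>v\<close>, and these pieces weigh \<open>path_weight w P - w e\<close>.\<close>

lemma twice_edge_minus_path_weight_le:
  assumes \<rho>: "\<rho> \<in> pseudometrics_extending G w" and P: "P \<in> paths G u v" and e: "e \<in> edges P"
  shows "2 * w e - path_weight w P \<le> \<rho> (u, v)"
proof -
  obtain k x where *: "path_enum G k x" "x 0 = u" "x k = v" "P = path_of k x"
    using P by (rule pathsE)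
  obtain i where i: "i < k" "e = {x i, x (Suc i)}" using e * by (auto simp: path_of_def)
  have V: "u \<in> verts G" "v \<in> verts G" "x i \<in> verts G" "x (Suc i) \<in> verts G"
    using path_enum_vert[OF *(1)] * i by auto
  have psm: "\<rho> (a, b) = \<rho> (b, a)" "\<rho> (a, b) \<le> \<rho> (a, c) + \<rho> (c, b)"
    if "a \<in> verts G" "b \<in> verts G" "c \<in> verts G" for a b c
    using \<rho> that by (auto simp: pseudometrics_extending_def pseudometric_on_def)
  have "path_weight w P =
      (\<Sum>l=0..<i. w {x l, x (Suc l)}) + w e + (\<Sum>l=Suc i..<k. w {x l, x (Suc l)})"
    using * i sum.atLeastLessThan_concat[of 0 i k "\<lambda>l. w {x l, x (Suc l)}"]
    by (simp add: path_weight_path_of sum.atLeast_Suc_lessThan flip: atLeast0LessThan)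
  moreover have "w e = \<rho> (x i, x (Suc i))"
    using \<rho> V i path_enum_edge[OF *(1)] by (auto simp: pseudometrics_extending_def)
  moreover have "\<rho> (x i, x (Suc i)) \<le> \<rho> (u, x i) + \<rho> (u, v) + \<rho> (x (Suc i), v)"
    using psm(2)[OF V(3,4,1)] psm(2)[OF V(1,4,2)] psm(1)[OF V(3,1,1)] psm(1)[OF V(2,4,4)]
    by linarith
  ultimately show ?thesis
    using pseudometrics_extending_chain[OF \<rho> *(1), of 0 i]
      pseudometrics_extending_chain[OF \<rho> *(1), of "Suc i" k] * i by simp
qed

section \<open>Construction of paths\<close>

lemma finite_edges_path: "P \<in> paths G u v \<Longrightarrow> finite (edges P)"
  by (auto elim!: pathsE simp: path_of_def)

lemma edges_path_nonempty: "P \<in> paths G u v \<Longrightarrow> u \<noteq> v \<Longrightarrow> edges P \<noteq> {}"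
  by (fastforce elim!: pathsE simp: path_of_def lessThan_empty_iff bot_nat_def)

lemma trivial_path_enum: "u \<in> verts G \<Longrightarrow> path_enum G 0 (\<lambda>_. u)"
  by (simp add: path_enum_def)

lemma edge_path_in_paths:
  assumes "u \<in> verts G" "v \<in> verts G" "{u, v} \<in> edges G" "u \<noteq> v"
  obtains P where "P \<in> paths G u v" "path_weight w P = w {u, v}"
proof -
  define x where "x i = (if i = 0 then u else v)" for i :: nat
  have "{..1::nat} = {0, 1}" by auto
  then have p: "path_enum G 1 x"
    using assms by (auto simp: path_enum_def x_def)
  show thesis
    using that[of "path_of 1 x"] path_of_in_paths[OF p] path_weight_path_of[OF p, of w]
    by (simp add: x_def)
qed

text \<open>The concatenation of the two vertex sequences is again injective because the paths share
  no vertex; this yields a path from \<open>u\<close> to \<open>v\<close> through a prescribed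
  edge.\<close>

lemma join_disjoint_paths:
  assumes P: "P \<in> paths G u a" and Q: "Q \<in> paths G b v"
    and e: "{a, b} \<in> edges G" and disj: "verts P \<inter> verts Q = {}"
  obtains R where "R \<in> paths G u v" "{a, b} \<in> edges R"
    "path_weight w R = path_weight w P + w {a, b} + path_weight w Q"
proof -
  obtain k x where x: "path_enum G k x" "x 0 = u" "x k = a" "P = path_of k x"
    using P by (rule pathsE)
  obtain l y where y: "path_enum G l y" "y 0 = b" "y l = v" "Q = path_of l y"
    using Q by (rule pathsE)
  have xy: "x i \<noteq> y j" if "i \<le> k" "j \<le> l" for i j
    using disj that x y by (auto simp: path_of_def)
  \<comment> \<open>The first path occupies the indices up to \<open>k\<close>, the second starts at
    \<open>Suc k\<close>, and the joining edge is the one with index \<open>k\<close>.\<close>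
  define z where "z i = (if i \<le> k then x i else y (i - Suc k))" for i
  have zx: "z i = x i" if "i \<le> k" for i using that by (simp add: z_def)
  have zy: "z (Suc k + j) = y j" for j by (simp add: z_def)
  have split: "i \<le> k \<or> (\<exists>j\<le>l. i = Suc k + j)" if "i \<le> Suc k + l" for i
    using that le_add_diff_inverse[of "Suc k" i]
    by (metis nat_add_left_cancel_le not_less_eq_eq)
  have z_join: "{z k, z (Suc k)} = {a, b}"
    using zx[of k] zy[of 0] x y by simp
  have step: "{z i, z (Suc i)} \<in> edges G" if i: "i < Suc k + l" for i
  proof -
    consider "i < k" | "i = k" | j where "i = Suc k + j" "j < l"
      using i le_add_diff_inverse[of "Suc k" i] by (metis Suc_leI nat_add_left_cancel_less nat_neq_iff)
    then show ?thesis
    proof cases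
      case 1
      then show ?thesis using path_enum_edge[OF x(1)] by (simp add: zx)
    next
      case 2
      then show ?thesis using e z_join by simp
    next
      case 3
      then show ?thesis
        using path_enum_edge[OF y(1), of j] zy[of j] zy[of "Suc j"] by simp
    qed
  qed
  have "inj_on z {..Suc k + l}"
  proof (rule inj_onI)
    fix i j assume ij: "i \<in> {..Suc k + l}" "j \<in> {..Suc k + l}" "z i = z j"
    have inj: "inj_on x {..k}" "inj_on y {..l}" using x y by (auto simp: path_enum_def)
    from split[of i] split[of j] ij(1,2) consider "i \<le> k" "j \<le> k"
      | j' where "i \<le> k" "j = Suc k + j'" "j' \<le> l"
      | i' where "i = Suc k + i'" "i' \<le> l" "j \<le> k"
      | i' j' where "i = Suc k + i'" "i' \<le> l" "j = Suc k + j'" "j' \<le> l"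
      unfolding atMost_iff by blast
    then show "i = j"
    proof cases
      case 1
      then show ?thesis using ij(3) inj_onD[OF inj(1), of i j] by (simp add: zx)
    next
      case (2 j')
      then show ?thesis using ij(3) xy[of i j'] zx[of i] zy[of j'] by metis
    next
      case (3 i')
      then show ?thesis using ij(3) xy[of j i'] zx[of j] zy[of i'] by metis
    next
      case (4 i' j')
      then have "y i' = y j'" using ij(3) zy[of i'] zy[of j'] by metis
      then show ?thesis using 4 inj_onD[OF inj(2), of i' j'] by simp
    qed
  qed
  moreover have "z i \<in> verts G" if "i \<le> Suc k + l" for i
    using split[OF that] path_enum_vert[OF x(1)] path_enum_vert[OF y(1)] zx zy by metis
  ultimately have z: "path_enum G (Suc k + l) z"
    using step by (auto simp: path_enum_def)
  \<comment> \<open>The upper limit \<open>m\<close> replaces \<open>l\<close> so that induction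
    applies; the identity does not refer to where the second path ends.\<close>
  have "(\<Sum>i<Suc k + m. w {z i, z (Suc i)}) =
      (\<Sum>i<k. w {x i, x (Suc i)}) + w {a, b} + (\<Sum>i<m. w {y i, y (Suc i)})" for m
  proof (induction m)
    case 0
    have "(\<Sum>i<k. w {z i, z (Suc i)}) = (\<Sum>i<k. w {x i, x (Suc i)})"
      by (intro sum.cong) (simp_all add: zx)
    then show ?case using z_join by simp
  next
    case (Suc m)
    then show ?case using zy[of m] zy[of "Suc m"] by simp
  qed
  then have weight: "path_weight w (path_of (Suc k + l) z) =
      path_weight w P + w {a, b} + path_weight w Q"
    unfolding x(4) y(4) path_weight_path_of[OF x(1)] path_weight_path_of[OF y(1)]
      path_weight_path_of[OF z] .
  have "{a, b} \<in> edges (path_of (Suc k + l) z)"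
    unfolding path_of_def z_join[symmetric] by simp
  moreover have "path_of (Suc k + l) z \<in> paths G u v"
    using path_of_in_paths[OF z] zx[of 0] zy[of l] x y by simp
  ultimately show thesis using weight that by blast
qed

section \<open>The shortest-path pseudometric as the largest extension\<close>

text \<open>The case \<open>u = v\<close> is covered as well: the one-vertex path has weight 0 and
  forces \<open>c \<le> 0\<close>. Later uses thus need no distinctness of the end points.\<close>

lemma sp_dist_greatest:
  assumes "connected_graph G" "u \<in> verts G" "v \<in> verts G"
    and "\<And>P. P \<in> paths G u v \<Longrightarrow> c \<le> path_weight w P"
  shows "c \<le> sp_dist G w (u, v)"
proof (cases "u = v")
  case True
  have "path_of 0 (\<lambda>_. u) \<in> paths G u v"
    using path_of_in_paths[OF trivial_path_enum[OF assms(2)]] True by simp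
  then have "c \<le> 0" using assms(4) by (fastforce simp: path_weight_def path_of_def)
  then show ?thesis using True assms by (simp add: sp_dist_def)
next
  case False
  then have "c \<le> (INF P\<in>paths G u v. path_weight w P)"
    using assms by (intro cINF_greatest) (auto simp: connected_graph_def)
  then show ?thesis using False assms by (simp add: sp_dist_def)
qed

lemma sp_dist_le_path_weight:
  assumes "weighted_graph G w" "u \<in> verts G" "v \<in> verts G" "u \<noteq> v" "P \<in> paths G u v"
  shows "sp_dist G w (u, v) \<le> path_weight w P"
proof -
  have "bdd_below (path_weight w ` paths G u v)"
    using assms(1)
    by (intro bdd_belowI2[of _ 0])
      (auto simp: path_weight_def weighted_graph_def paths_def subgraph_def intro!: sum_nonneg)
  then show ?thesis
    using assms by (auto simp: sp_dist_def intro: cINF_lower)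
qed

lemma pseudometrics_extending_le_sp_dist:
  assumes "connected_graph G" "\<rho> \<in> pseudometrics_extending G w" "u \<in> verts G" "v \<in> verts G"
  shows "\<rho> (u, v) \<le> sp_dist G w (u, v)"
  using sp_dist_greatest pseudometrics_extending_le_path_weight assms by metis

text \<open>On an edge, the one-edge path bounds the distance from above by the weight, and any
  pseudometric extending \<open>w\<close> bounds it from below.\<close>

lemma sp_dist_in_pseudometrics_extending:
  assumes w: "weighted_graph G w" and G: "connected_graph G" and m: "metrizable G w"
  shows "sp_dist G w \<in> pseudometrics_extending G w"
  unfolding pseudometrics_extending_def
proof (intro CollectI conjI ballI impI)
  show "pseudometric_on (verts G) (sp_dist G w)"
    using m by (simp add: metrizable_def metric_on_def)
next
  fix u v assume uv: "u \<in> verts G" "v \<in> verts G" "{u, v} \<in> edges G"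
  then have "u \<noteq> v"
    using w by (fastforce simp: weighted_graph_def simple_graph_def)
  then obtain P where "P \<in> paths G u v" "path_weight w P = w {u, v}"
    using edge_path_in_paths uv by metis
  then have "sp_dist G w (u, v) \<le> w {u, v}"
    using sp_dist_le_path_weight[OF w uv(1,2) \<open>u \<noteq> v\<close>] by metis
  moreover obtain \<rho> where "\<rho> \<in> pseudometrics_extending G w"
    using m by (auto simp: metrizable_def pseudometrizable_def)
  then have "w {u, v} \<le> sp_dist G w (u, v)"
    using pseudometrics_extending_le_sp_dist[OF G _ uv(1,2)] uv
    by (fastforce simp: pseudometrics_extending_def)
  ultimately show "sp_dist G w (u, v) = w {u, v}" by simp
qed

section \<open>Adding a shortcut to a pseudometric\<close>

text \<open>The distance after adding a connection of length \<open>t\<close> between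
  \<open>u\<close> and \<open>v\<close>. Three routes suffice, since crossing the connection more
  than once never pays off.\<close>

definition shortcut :: "'a set \<Rightarrow> ('a \<times> 'a \<Rightarrow> real) \<Rightarrow> 'a \<Rightarrow> 'a \<Rightarrow> real \<Rightarrow> 'a \<times> 'a \<Rightarrow> real" where
  "shortcut X d u v t = (\<lambda>(x, y)\<in>X \<times> X.
     min (d (x, y)) (min (d (x, u) + t + d (v, y)) (d (x, v) + t + d (u, y))))"

lemma pseudometric_on_shortcut:
  assumes d: "pseudometric_on X d" and uv: "u \<in> X" "v \<in> X" and t: "0 \<le> t"
  shows "pseudometric_on X (shortcut X d u v t)"
proof -
  have nonneg: "0 \<le> d (x, y)" if "x \<in> X" "y \<in> X" for x y
    using d that by (auto simp: pseudometric_on_def PiE_def Pi_def)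
  have refl: "d (x, x) = 0" if "x \<in> X" for x
    using d that by (auto simp: pseudometric_on_def)
  have sym: "d (x, y) = d (y, x)" if "x \<in> X" "y \<in> X" for x y
    using d that by (auto simp: pseudometric_on_def)
  have tri: "d (x, y) \<le> d (x, z) + d (z, y)" if "x \<in> X" "y \<in> X" "z \<in> X" for x y z
    using d that by (auto simp: pseudometric_on_def)
  show ?thesis
    unfolding pseudometric_on_def
  proof (intro conjI ballI)
    show "shortcut X d u v t \<in> X \<times> X \<rightarrow>\<^sub>E {0..}"
      using nonneg uv t by (auto simp: shortcut_def)
  next
    fix x assume "x \<in> X"
    then show "shortcut X d u v t (x, x) = 0"
      using nonneg uv t refl by (auto simp: shortcut_def min_def)
  next
    fix x y assume "x \<in> X" "y \<in> X"
    then show "shortcut X d u v t (x, y) = shortcut X d u v t (y, x)"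
      using uv by (simp add: shortcut_def sym[of x] sym[of y u] sym[of y v] min.commute add_ac)
  next
    fix x y z assume xyz: "x \<in> X" "y \<in> X" "z \<in> X"
    let ?s = "shortcut X d u v t"
    have upper: "?s (x, y) \<le> d (x, y)" "?s (x, y) \<le> d (x, u) + t + d (v, y)"
      "?s (x, y) \<le> d (x, v) + t + d (u, y)"
      using xyz by (simp_all add: shortcut_def)
    have cases: "?s (a, b) = d (a, b) \<or> ?s (a, b) = d (a, u) + t + d (v, b) \<or>
        ?s (a, b) = d (a, v) + t + d (u, b)" if "a \<in> X" "b \<in> X" for a b
      using that by (simp add: shortcut_def min_def)
    \<comment> \<open>Nine cases arise, one for each choice of routes on the two legs. Two crossings
      in the same direction can be replaced by one, two in opposite directions by none, at no extra
      cost.\<close>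
    note facts = upper t tri[OF xyz] tri[OF xyz(1) uv(1) xyz(3)] tri[OF xyz(1) uv(2) xyz(3)]
      tri[OF uv(1) xyz(2,3)] tri[OF uv(2) xyz(2,3)] tri[OF xyz(1,2) uv(1)] tri[OF xyz(1,2) uv(2)]
      sym[OF xyz(3) uv(1)] sym[OF xyz(3) uv(2)] nonneg[OF uv(1) xyz(3)] nonneg[OF uv(2) xyz(3)]
    from cases[OF xyz(1,3)] cases[OF xyz(3,2)]
    show "?s (x, y) \<le> ?s (x, z) + ?s (z, y)"
      by (elim disjE) (use facts in linarith)+
  qed
qed

lemma shortcut_in_pseudometrics_extending:
  assumes w: "weighted_graph G w" and G: "connected_graph G" and m: "metrizable G w"
    and uv: "u \<in> verts G" "v \<in> verts G" and t: "0 \<le> t"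
    and bound: "\<And>P e. P \<in> paths G u v \<Longrightarrow> e \<in> edges P \<Longrightarrow> 2 * w e - path_weight w P \<le> t"
  shows "shortcut (verts G) (sp_dist G w) u v t \<in> pseudometrics_extending G w"
proof -
  let ?d = "sp_dist G w"
  have ext: "?d \<in> pseudometrics_extending G w"
    using sp_dist_in_pseudometrics_extending[OF w G m] .
  then have psm: "pseudometric_on (verts G) ?d"
    by (simp add: pseudometrics_extending_def)
  have sym: "?d (x, y) = ?d (y, x)" if "x \<in> verts G" "y \<in> verts G" for x y
    using psm that by (auto simp: pseudometric_on_def)
  have tri: "?d (x, y) \<le> ?d (x, z) + ?d (z, y)"
    if "x \<in> verts G" "y \<in> verts G" "z \<in> verts G" for x y z
    using psm that by (auto simp: pseudometric_on_def)
  have nonneg: "0 \<le> ?d (x, y)" if "x \<in> verts G" "y \<in> verts G" for x y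
    using psm that by (auto simp: pseudometric_on_def PiE_def Pi_def)
  have edge: "?d (x, y) = w {x, y}" if "x \<in> verts G" "y \<in> verts G" "{x, y} \<in> edges G" for x y
    using ext that by (auto simp: pseudometrics_extending_def)
  \<comment> \<open>This says that the shortcut does not shorten the edge when crossed from
    \<open>u\<close> to \<open>v\<close>; the other direction follows by exchanging \<open>x\<close>
    and \<open>y\<close>.\<close>
  have detour: "w {x, y} \<le> ?d (u, x) + t + ?d (y, v)"
    if xy: "x \<in> verts G" "y \<in> verts G" "{x, y} \<in> edges G" for x y
  proof -
    have le: "w {x, y} \<le> path_weight w P + t + path_weight w Q"
      if P: "P \<in> paths G u x" and Q: "Q \<in> paths G y v" for P Q
    proof (cases "verts P \<inter> verts Q = {}")
      case True
      obtain R where "R \<in> paths G u v" "{x, y} \<in> edges R"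
        "path_weight w R = path_weight w P + w {x, y} + path_weight w Q"
        \<comment> \<open>Applied to the joined path \<open>R\<close>, the hypothesis
          \<open>bound\<close> cancels one of the two copies of the edge weight.\<close>
        using join_disjoint_paths[OF P Q xy(3) True] by metis
      then show ?thesis using bound[of R "{x, y}"] by simp
    next
      case False
      then obtain z where z: "z \<in> verts P" "z \<in> verts Q" by auto
      then have zV: "z \<in> verts G"
        using P by (auto simp: paths_def subgraph_def)
      show ?thesis
        \<comment> \<open>Through the common vertex \<open>z\<close> the paths already connect
          \<open>x\<close> and \<open>y\<close>, so their total weight is at least that of the
          edge.\<close>
        using pseudometrics_extending_via_le_path_weight[OF ext P z(1)]
          pseudometrics_extending_via_le_path_weight[OF ext Q z(2)]
          tri[OF xy(1,2) zV] sym[OF xy(1) zV] sym[OF xy(2) zV] edge[OF xy]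
          nonneg[OF uv(1) zV] nonneg[OF zV uv(2)] t
        by linarith
    qed
    \<comment> \<open>The infimum is taken over \<open>P\<close> with \<open>Q\<close> fixed, then
      over \<open>Q\<close>.\<close>
    have "w {x, y} - t - path_weight w Q \<le> ?d (u, x)" if "Q \<in> paths G y v" for Q
      by (rule sp_dist_greatest[OF G uv(1) xy(1)]) (use le that in fastforce)
    then have "w {x, y} - t - ?d (u, x) \<le> ?d (y, v)"
      by (intro sp_dist_greatest[OF G xy(2) uv(2)]) fastforce
    then show ?thesis by linarith
  qed
  show ?thesis
    unfolding pseudometrics_extending_def
  proof (intro CollectI conjI ballI impI)
    show "pseudometric_on (verts G) (shortcut (verts G) ?d u v t)"
      by (rule pseudometric_on_shortcut[OF psm uv t])
  next
    fix x y assume xy: "x \<in> verts G" "y \<in> verts G" "{x, y} \<in> edges G"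
    then have "{y, x} \<in> edges G" by (simp add: insert_commute)
    then show "shortcut (verts G) ?d u v t (x, y) = w {x, y}"
      using xy detour[OF xy] detour[of y x] edge[OF xy] sym[OF xy(1) uv(1)] sym[OF xy(1) uv(2)]
        sym[OF xy(2) uv(1)] sym[OF xy(2) uv(2)]
      by (simp add: shortcut_def insert_commute)
  qed
qed

section \<open>Uniqueness and the path condition\<close>

lemma Max_edge_minus_path_weight_le:
  assumes "\<rho> \<in> pseudometrics_extending G w" "P \<in> paths G u v" "u \<noteq> v"
  shows "2 * (MAX e\<in>edges P. w e) - path_weight w P \<le> \<rho> (u, v)"
proof -
  have "(MAX e\<in>edges P. w e) \<in> w ` edges P"
    using finite_edges_path[OF assms(2)] edges_path_nonempty[OF assms(2,3)] by (intro Max_in) auto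
  then show ?thesis
    using twice_edge_minus_path_weight_le[OF assms(1,2)] by auto
qed

text \<open>Values on the diagonal and on edges are forced. Elsewhere every term of the sequence is
  a lower bound for \<open>\<rho> (u, v)\<close>, hence so is its limit, which is the largest value
  possible.\<close>

lemma pseudometrics_extending_unique:
  assumes w: "weighted_graph G w" and G: "connected_graph G" and m: "metrizable G w"
    and cond: "path_condition G w" and \<rho>: "\<rho> \<in> pseudometrics_extending G w"
    and uv: "u \<in> verts G" "v \<in> verts G"
  shows "\<rho> (u, v) = sp_dist G w (u, v)"
proof -
  have ext: "sp_dist G w \<in> pseudometrics_extending G w"
    using sp_dist_in_pseudometrics_extending[OF w G m] .
  consider "u = v" | "adjacent G u v" | "u \<noteq> v" "\<not> adjacent G u v" by blast
  then show ?thesis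
  proof cases
    case 1
    then show ?thesis
      using ext \<rho> uv by (simp add: pseudometrics_extending_def pseudometric_on_def)
  next
    case 2
    then show ?thesis
      using ext \<rho> uv by (simp add: pseudometrics_extending_def adjacent_def)
  next
    case 3
    then obtain P where P: "\<And>n. P n \<in> paths G u v" and
      lim: "(\<lambda>n. 2 * (MAX e\<in>edges (P n). w e) - path_weight w (P n))
        \<longlonglongrightarrow> sp_dist G w (u, v)"
      using cond uv unfolding path_condition_def tends_from_below_def by metis
    have "sp_dist G w (u, v) \<le> \<rho> (u, v)"
      using Max_edge_minus_path_weight_le[OF \<rho> P 3(1)] by (intro LIMSEQ_le_const2[OF lim]) auto
    then show ?thesis
      using pseudometrics_extending_le_sp_dist[OF G \<rho> uv] by simp
  qed
qed

lemma path_condition_of_unique: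
  assumes w: "weighted_graph G w" and G: "connected_graph G" and m: "metrizable G w"
    and unique: "\<And>\<rho>. \<rho> \<in> pseudometrics_extending G w \<Longrightarrow> \<rho> = sp_dist G w"
  shows "path_condition G w"
  unfolding path_condition_def
proof (intro ballI impI)
  fix u v assume uv: "u \<in> verts G" "v \<in> verts G" and "u \<noteq> v \<and> \<not> adjacent G u v"
  then have "u \<noteq> v" by simp
  let ?d = "sp_dist G w" and ?f = "\<lambda>P. 2 * (MAX e\<in>edges P. w e) - path_weight w P"
  have ext: "?d \<in> pseudometrics_extending G w"
    using sp_dist_in_pseudometrics_extending[OF w G m] .
  have psm: "pseudometric_on (verts G) ?d"
    using ext by (simp add: pseudometrics_extending_def)
  \<comment> \<open>Here the distance has to be a metric: positivity leaves room for a shortcut of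
    nonnegative length strictly below it.\<close>
  have "?d (u, v) \<noteq> 0"
    using m uv \<open>u \<noteq> v\<close> by (auto simp: metrizable_def metric_on_def)
  moreover have "0 \<le> ?d (u, v)"
    using psm uv by (auto simp: pseudometric_on_def PiE_def Pi_def)
  ultimately have pos: "0 < ?d (u, v)" by simp
  have approx: "\<exists>P\<in>paths G u v. ?d (u, v) - \<epsilon> < ?f P" if "0 < \<epsilon>" for \<epsilon>
  proof (rule ccontr)
    assume *: "\<not> ?thesis"
    \<comment> \<open>Truncation at 0 keeps the length admissible when \<open>\<epsilon>\<close>
      exceeds the distance.\<close>
    define t where "t = max 0 (?d (u, v) - \<epsilon>)"
    have "2 * w e - path_weight w P \<le> t" if "P \<in> paths G u v" "e \<in> edges P" for P e
    proof -
      have "w e \<le> (MAX e\<in>edges P. w e)"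
        using that finite_edges_path[OF that(1)] by (intro Max_ge) auto
      then show ?thesis using * that by (force simp: t_def)
    qed
    then have "shortcut (verts G) ?d u v t = ?d"
      by (intro unique shortcut_in_pseudometrics_extending[OF w G m uv]) (auto simp: t_def)
    \<comment> \<open>The route that consists of the shortcut alone has length \<open>t\<close>, so
      the new pseudometric differs from \<open>?d\<close> at this pair.\<close>
    moreover have "shortcut (verts G) ?d u v t (u, v) \<le> t"
      using psm uv by (simp add: shortcut_def pseudometric_on_def)
    moreover have "t < ?d (u, v)" using pos that by (simp add: t_def)
    ultimately show False by simp
  qed
  have "\<forall>n. \<exists>P\<in>paths G u v. ?d (u, v) - inverse (real (Suc n)) < ?f P"
    by (intro allI approx) simp
  then obtain P where P: "\<And>n. P n \<in> paths G u v"
    and gt: "\<And>n. ?d (u, v) - inverse (real (Suc n)) < ?f (P n)"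
    by metis
  \<comment> \<open>The polygon bound for \<open>?d\<close> itself gives the one-sidedness for every
    \<open>n\<close>.\<close>
  have le: "?f (P n) \<le> ?d (u, v)" for n
    using Max_edge_minus_path_weight_le[OF ext P \<open>u \<noteq> v\<close>] .
  have "(\<lambda>n. ?d (u, v) - inverse (real (Suc n))) \<longlonglongrightarrow> ?d (u, v)"
    using tendsto_diff[OF tendsto_const LIMSEQ_inverse_real_of_nat] by simp
  then have "(\<lambda>n. ?f (P n)) \<longlonglongrightarrow> ?d (u, v)"
    by (rule tendsto_sandwich[rotated 2, OF _ tendsto_const])
      (use gt le in \<open>auto intro!: always_eventually less_imp_le\<close>)
  then show "\<exists>P. (\<forall>n. P n \<in> paths G u v) \<and> tends_from_below (\<lambda>n. ?f (P n)) (?d (u, v))"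
    using P le unfolding tends_from_below_def by blast
qed

theorem theorem2p1:
  fixes G :: "'a ugraph" and w :: "'a set \<Rightarrow> real"
  assumes "weighted_graph G w"
    and "connected_graph G"
    and "metrizable G w"
  shows "((\<exists>!\<rho>. \<rho> \<in> pseudometrics_extending G w) \<longleftrightarrow> path_condition G w) \<and>
    (path_condition G w \<longrightarrow>
      (\<forall>\<rho>\<in>pseudometrics_extending G w. \<forall>u\<in>verts G. \<forall>v\<in>verts G.
        \<rho> (u, v) = sp_dist G w (u, v)))"
proof (intro conjI iffI impI ballI)
  have ext: "sp_dist G w \<in> pseudometrics_extending G w"
    using sp_dist_in_pseudometrics_extending[OF assms] .
  {
    assume "\<exists>!\<rho>. \<rho> \<in> pseudometrics_extending G w"
    then show "path_condition G w"
      using path_condition_of_unique[OF assms] ext by blast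
  next
    assume cond: "path_condition G w"
    show "\<exists>!\<rho>. \<rho> \<in> pseudometrics_extending G w"
    proof (rule ex1I, rule ext)
      fix \<rho> assume \<rho>: "\<rho> \<in> pseudometrics_extending G w"
      show "\<rho> = sp_dist G w"
      \<comment> \<open>Both functions are \<open>undefined\<close> off the pairs of vertices, so
        agreement on these pairs is equality.\<close>
      proof (rule PiE_ext)
        show "\<rho> \<in> verts G \<times> verts G \<rightarrow>\<^sub>E {0..}" "sp_dist G w \<in> verts G \<times> verts G \<rightarrow>\<^sub>E {0..}"
          using \<rho> ext by (auto simp: pseudometrics_extending_def pseudometric_on_def)
      qed (use pseudometrics_extending_unique[OF assms cond \<rho>] in auto)
    qed
  }
next
  fix \<rho> u v
  assume "path_condition G w" "\<rho> \<in> pseudometrics_extending G w" "u \<in> verts G" "v \<in> verts G"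
  then show "\<rho> (u, v) = sp_dist G w (u, v)"
    using pseudometrics_extending_unique[OF assms] by blast
qed

end
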